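(* Let $m\ge 1$, $n\ge 1$, and let $a_0,b_1,\dots,b_n$ be positive integers. Let $\mathfrak R$ be a radial part with root $v_0$, built from data $a_0,b_1,\dots,b_n$ and rooted graphs $(H_1,v_1),\dots,(H_n,v_n)$ in the class $\mathcal C$, all as described in the context. For $1\le i\le n$ let $$A_i=\frac{Z(H_i)}{Z(H_i-v_i)}.$$ When $H_i$ is a star with $A_i-1$ leaves, $A_i$ is a positive integer; in general $A_i$ is the value of the (branched) continued fraction describing $H_i$. Let $G$ be the $m$-fold radial graph obtained by taking $m$ disjoint copies of $\mathfrak R$ and identifying their roots $v_0$ into a single vertex. Then the Hosoya index of $G$ is the numerator of the convergent of the multidimensional continued fraction $$ m(a_0-1)+1+\underbrace{\cfrac{b_1}{A_1+\cfrac{b_2}{A_2+\ddots+\cfrac{b_n}{A_n}}}+\cdots+\cfrac{b_1}{A_1+\cfrac{b_2}{A_2+\ddots+\cfrac{b_n}{A_n}}}}_{m\ \text{summands}}, $$ computed without cancellation so that its denominator is $Z(\mathfrak R-v_0)^m$. Explicitly, $$ Z(G)=Z(\mathfrak R-v_0)^m\left(m(a_0-1)+1+m\cdot\cfrac{b_1}{A_1+\cfrac{b_2}{A_2+\ddots+\cfrac{b_n}{A_n}}}\right). $$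
   Context: Graphs may have parallel edges. The Hosoya index $Z(G)$ of a finite multigraph $G$ is the number of sets of pairwise vertex-disjoint edges of $G$, including the empty set, with parallel edges counted as distinct. For a vertex $v$, $G-v$ denotes $G$ with $v$ and its incident edges deleted. The class $\mathcal C$ of rooted multigraphs (branched caterpillar-bond graphs) is defined recursively. A rooted multigraph $(H,v)$ belongs to $\mathcal C$ if $H$ consists of: - the root $v$ with some number $k\ge 0$ of pendant vertices attached; - a path $v=w_0,w_1,\dots,w_t$ with $t\ge 0$, where $w_{j-1}$ and $w_j$ are joined by $d_j\ge 1$ parallel edges; - for each $j\ge 1$, a rooted graph $(H'_j,w_j)\in\mathcal C$ attached at $w_j$, sharing only the vertex $w_j$ with the rest of $H$. A star with $c-1$ leaves rooted at its center belongs to $\mathcal C$ (take $t=0$). A radial part $\mathfrak R$ with data $a_0,b_1,\dots,b_n$ and rooted graphs $(H_1,v_1),\dots,(H_n,v_n)$ in $\mathcal C$ is built as follows: - a root $v_0$ (the marked vertex) carrying $a_0-1$ pendant vertices; - a path $v_0,v_1,\dots,v_n$ in which $v_{i-1}$ and $v_i$ are joined by $b_i$ parallel edges; - for each $1\le i\le n$, the graph $H_i$ attached at $v_i$, meeting the rest of $\mathfrak R$ only in $v_i$. In the plain caterpillar-bond case each $H_i$ is a star with $A_i-1$ leaves centered at $v_i$. *)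

theory Defs
  imports Complex_Main "HOL-Library.Disjoint_Sets"
begin

section \<open>Finite multigraphs and the Hosoya index\<close>

record ('v, 'e) mgraph =
  verts :: "'v set"
  edges :: "'e set"
  ends :: "'e \<Rightarrow> 'v set"

text \<open>Edges are identified by their names, so parallel edges are distinct elements of
  \<^term>\<open>edges G\<close> with the same set of ends. Loops are excluded.\<close>

definition finite_multigraph :: "('v, 'e) mgraph \<Rightarrow> bool" where
  "finite_multigraph G \<longleftrightarrow>
     finite (verts G) \<and> finite (edges G) \<and>
     (\<forall>e\<in>edges G. ends G e \<subseteq> verts G \<and> card (ends G e) = 2)"

definition matching :: "('v, 'e) mgraph \<Rightarrow> 'e set \<Rightarrow> bool" where
  "matching G M \<longleftrightarrow> M \<subseteq> edges G \<and> pairwise (\<lambda>e f. disjnt (ends G e) (ends G f)) M"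

definition hosoya :: "('v, 'e) mgraph \<Rightarrow> nat" where
  "hosoya G = card {M. matching G M}"

definition del_vert :: "('v, 'e) mgraph \<Rightarrow> 'v \<Rightarrow> ('v, 'e) mgraph" where
  "del_vert G v =
     \<lparr>verts = verts G - {v}, edges = {e \<in> edges G. v \<notin> ends G e}, ends = ends G\<rparr>"

definition subgraph :: "('v, 'e) mgraph \<Rightarrow> ('v, 'e) mgraph \<Rightarrow> bool" where
  "subgraph H G \<longleftrightarrow>
     finite_multigraph H \<and> verts H \<subseteq> verts G \<and> edges H \<subseteq> edges G \<and>
     (\<forall>e\<in>edges H. ends H e = ends G e)"

definition edges_between :: "('v, 'e) mgraph \<Rightarrow> 'v \<Rightarrow> 'v \<Rightarrow> 'e set" where
  "edges_between G x y = {e \<in> edges G. ends G e = {x, y}}"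

definition star :: "('v, 'e) mgraph \<Rightarrow> 'v \<Rightarrow> nat \<Rightarrow> bool" where
  "star G c k \<longleftrightarrow>
     finite_multigraph G \<and> c \<in> verts G \<and> card (verts G - {c}) = k \<and>
     (\<forall>p\<in>verts G - {c}. card (edges_between G c p) = 1) \<and>
     edges G = (\<Union>p\<in>verts G - {c}. edges_between G c p)"


section \<open>Branched caterpillar-bond graphs and radial parts\<close>

text \<open>\<open>G\<close> consists of the root \<open>w 0\<close> with a set \<open>P\<close> of \<open>k\<close> pendant vertices, the path
  \<open>w 0, \<dots>, w t\<close> whose \<open>j\<close>-th link consists of \<open>d j\<close> parallel edges, and for each
  \<open>1 \<le> j \<le> t\<close> the subgraph \<open>H j\<close> attached at \<open>w j\<close>. Values of \<open>w\<close>, \<open>d\<close>, \<open>H\<close> at other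
  indices play no role. The pieces \<open>{w 0}\<close>, \<open>P\<close>, \<open>verts (H 1)\<close>, \<dots>, \<open>verts (H t)\<close> partition
  the vertices; since \<open>w j\<close> is a vertex of \<open>H j\<close>, this makes the \<open>w j\<close> distinct and lets \<open>H j\<close>
  meet the rest of \<open>G\<close> in \<open>w j\<close> only.\<close>

definition spine_decomp ::
  "('v, 'e) mgraph \<Rightarrow> nat \<Rightarrow> (nat \<Rightarrow> 'v) \<Rightarrow> nat \<Rightarrow> (nat \<Rightarrow> nat) \<Rightarrow> (nat \<Rightarrow> ('v, 'e) mgraph) \<Rightarrow> bool"
  where
  "spine_decomp G k w t d H \<longleftrightarrow>
     finite_multigraph G \<and>
     (\<forall>j\<in>{1..t}. subgraph (H j) G \<and> w j \<in> verts (H j)) \<and>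
     disjoint_family_on (\<lambda>j. verts (H j)) {1..t} \<and>
     (\<exists>P. card P = k \<and>
        verts G = {w 0} \<union> P \<union> (\<Union>j\<in>{1..t}. verts (H j)) \<and>
        w 0 \<notin> P \<and> (\<forall>j\<in>{1..t}. w 0 \<notin> verts (H j) \<and> P \<inter> verts (H j) = {}) \<and>
        (\<forall>p\<in>P. card (edges_between G (w 0) p) = 1) \<and>
        (\<forall>j\<in>{1..t}. card (edges_between G (w (j - 1)) (w j)) = d j) \<and>
        edges G = (\<Union>p\<in>P. edges_between G (w 0) p)
                \<union> (\<Union>j\<in>{1..t}. edges_between G (w (j - 1)) (w j))
                \<union> (\<Union>j\<in>{1..t}. edges (H j)))"

inductive caterpillar_bond :: "('v, 'e) mgraph \<Rightarrow> 'v \<Rightarrow> bool" where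
  "\<lbrakk>spine_decomp G k w t d H; \<forall>j\<in>{1..t}. 1 \<le> d j;
    \<forall>j\<in>{1..t}. caterpillar_bond (H j) (w j)\<rbrakk>
   \<Longrightarrow> caterpillar_bond G (w 0)"

definition radial_part ::
  "('v, 'e) mgraph \<Rightarrow> (nat \<Rightarrow> 'v) \<Rightarrow> nat \<Rightarrow> nat \<Rightarrow> (nat \<Rightarrow> nat) \<Rightarrow> (nat \<Rightarrow> ('v, 'e) mgraph) \<Rightarrow> bool"
  where
  "radial_part R v n a0 b H \<longleftrightarrow>
     spine_decomp R (a0 - 1) v n b H \<and> (\<forall>i\<in>{1..n}. caterpillar_bond (H i) (v i))"

lemma star_caterpillar_bond:
  assumes "star G c k"
  shows "caterpillar_bond G c"
proof -
  have "spine_decomp G k (\<lambda>_. c) 0 (\<lambda>_. 1) (\<lambda>_. G)"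
    using assms unfolding spine_decomp_def star_def
    by (auto simp: disjoint_family_on_def intro!: exI[of _ "verts G - {c}"])
  then show ?thesis
    using caterpillar_bond.intros[of G k "\<lambda>_. c" 0] by simp
qed

text \<open>\<open>m\<close> disjoint copies of \<open>R\<close>, tagged by \<open>{..<m}\<close>, with all copies of the root \<open>r\<close>
  identified to the single vertex \<^term>\<open>None\<close>.\<close>

definition radial_vertex :: "'v \<Rightarrow> nat \<Rightarrow> 'v \<Rightarrow> (nat \<times> 'v) option" where
  "radial_vertex r i x = (if x = r then None else Some (i, x))"

definition radial_graph ::
  "nat \<Rightarrow> ('v, 'e) mgraph \<Rightarrow> 'v \<Rightarrow> ((nat \<times> 'v) option, nat \<times> 'e) mgraph" where
  "radial_graph m R r =
     \<lparr>verts = (\<Union>i\<in>{..<m}. radial_vertex r i ` verts R),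
      edges = {..<m} \<times> edges R,
      ends = (\<lambda>(i, e). radial_vertex r i ` ends R e)\<rparr>"


section \<open>Continued fractions\<close>

text \<open>The list \<open>[(b\<^sub>1, A\<^sub>1), \<dots>, (b\<^sub>n, A\<^sub>n)]\<close> denotes
  \<open>b\<^sub>1 / (A\<^sub>1 + b\<^sub>2 / (A\<^sub>2 + \<dots> + b\<^sub>n / A\<^sub>n))\<close>.\<close>

primrec cfrac :: "(nat \<times> real) list \<Rightarrow> real" where
  "cfrac [] = 0"
| "cfrac (x # xs) = real (fst x) / (snd x + cfrac xs)"

text \<open>The value of the branched continued fraction read off from a decomposition of a graph
  in the class.\<close>

inductive bcf_value :: "('v, 'e) mgraph \<Rightarrow> 'v \<Rightarrow> real \<Rightarrow> bool" where
  "\<lbrakk>spine_decomp G k w t d H; \<forall>j\<in>{1..t}. 1 \<le> d j;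
    \<forall>j\<in>{1..t}. bcf_value (H j) (w j) (x j)\<rbrakk>
   \<Longrightarrow> bcf_value G (w 0) (real k + 1 + cfrac (map (\<lambda>j. (d j, x j)) [1..<Suc t]))"

text \<open>Evaluation without cancellation: a pair \<open>(p, q)\<close> stands for the formal fraction \<open>p / q\<close>,
  which is never reduced. Adding \<open>(0, 1)\<close> leaves a formal fraction unchanged, so the
  empty tail contributes nothing.\<close>

definition ufrac_add :: "nat \<times> nat \<Rightarrow> nat \<times> nat \<Rightarrow> nat \<times> nat" where
  "ufrac_add x y = (fst x * snd y + fst y * snd x, snd x * snd y)"

definition ufrac_div :: "nat \<Rightarrow> nat \<times> nat \<Rightarrow> nat \<times> nat" where
  "ufrac_div b x = (b * snd x, fst x)"

primrec ucfrac :: "(nat \<times> nat \<times> nat) list \<Rightarrow> nat \<times> nat" where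
  "ucfrac [] = (0, 1)"
| "ucfrac (x # xs) = ufrac_div (fst x) (ufrac_add (snd x) (ucfrac xs))"

text \<open>The integer \<open>c\<close> plus \<open>m\<close> summands, each equal to the continued fraction \<open>xs\<close>.\<close>

definition umcfrac :: "nat \<Rightarrow> nat \<Rightarrow> (nat \<times> nat \<times> nat) list \<Rightarrow> nat \<times> nat" where
  "umcfrac c m xs = (ufrac_add (ucfrac xs) ^^ m) (c, 1)"

end

theory Submission
  imports Defs
begin

text \<open>A matching uses at most one edge from any pairwise intersecting family, such as a bond or the
  edges at a vertex. Applied to the bond joining \<open>v\<^sub>i\<close> to the tail \<open>T\<^sub>i\<^sub>+\<^sub>1\<close> of the spine, this gives
  \<open>Z(T\<^sub>i) = Z(H\<^sub>i) Z(T\<^sub>i\<^sub>+\<^sub>1) + b\<^sub>i\<^sub>+\<^sub>1 Z(H\<^sub>i - v\<^sub>i) Z(T\<^sub>i\<^sub>+\<^sub>1 - v\<^sub>i\<^sub>+\<^sub>1)\<close>, which together with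
  \<open>Z(T\<^sub>i - v\<^sub>i) = Z(H\<^sub>i - v\<^sub>i) Z(T\<^sub>i\<^sub>+\<^sub>1)\<close> is one uncancelled step of the continued fraction.
  Applied to the edges at the common root, with \<open>q = Z(R - v\<^sub>0)\<close>, it gives
  \<open>Z(G) = q\<^sup>m + m (Z(R) - q) q\<^sup>m\<^sup>-\<^sup>1\<close>, since a root edge leaves the other \<open>m - 1\<close> copies intact.\<close>

section \<open>Counting matchings of a set of edges\<close>

text \<open>The count depends only on the edges and their ends, so it is taken over an edge set with
  an end map. Tails of the spine, bonds and unions of copies can then be counted without being
  turned into graphs.\<close>

definition matchings :: "('e \<Rightarrow> 'v set) \<Rightarrow> 'e set \<Rightarrow> 'e set set" where
  "matchings f E = {M. M \<subseteq> E \<and> pairwise (\<lambda>e e'. disjnt (f e) (f e')) M}"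

definition mcount :: "('e \<Rightarrow> 'v set) \<Rightarrow> 'e set \<Rightarrow> nat" where
  "mcount f E = card (matchings f E)"

definition avoiding :: "('e \<Rightarrow> 'v set) \<Rightarrow> 'v \<Rightarrow> 'e set \<Rightarrow> 'e set" where
  "avoiding f x E = {e \<in> E. x \<notin> f e}"

lemma hosoya_eq_mcount: "hosoya G = mcount (ends G) (edges G)"
  by (simp add: hosoya_def mcount_def matchings_def matching_def)

lemma hosoya_del_vert_eq_mcount:
  "hosoya (del_vert G x) = mcount (ends G) (avoiding (ends G) x (edges G))"
  by (simp add: hosoya_eq_mcount del_vert_def avoiding_def)

lemma finite_matchings: "finite E \<Longrightarrow> finite (matchings f E)"
  unfolding matchings_def by (rule finite_subset[of _ "Pow E"]) auto

lemma mcount_pos: "finite E \<Longrightarrow> mcount f E > 0"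
proof -
  assume "finite E"
  moreover have "{} \<in> matchings f E" by (simp add: matchings_def)
  ultimately show ?thesis
    unfolding mcount_def using finite_matchings card_gt_0_iff by blast
qed

lemma mcount_empty [simp]: "mcount f {} = 1"
proof -
  have "matchings f {} = {{}}" by (auto simp: matchings_def)
  then show ?thesis by (simp add: mcount_def)
qed

text \<open>Only the pattern of disjointness among edges matters, so taking images under
  \<open>g\<close> is a bijection of matchings. This serves for tagged copies of edges as well as
  for a change of end map.\<close>

lemma mcount_reindex:
  assumes "inj_on g E"
    and "\<And>e e'. e \<in> E \<Longrightarrow> e' \<in> E \<Longrightarrow> disjnt (f' (g e)) (f' (g e')) \<longleftrightarrow> disjnt (f e) (f e')"
  shows "mcount f' (g ` E) = mcount f E"
proof -
  have eq: "g ` M \<in> matchings f' (g ` E) \<longleftrightarrow> M \<in> matchings f E" if "M \<subseteq> E" for M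
  proof -
    have "e \<in> E" if "e \<in> M" for e using that \<open>M \<subseteq> E\<close> by auto
    moreover have "g e = g e' \<longleftrightarrow> e = e'" if "e \<in> M" "e' \<in> M" for e e'
      using that \<open>M \<subseteq> E\<close> assms(1) by (meson inj_on_eq_iff subsetD)
    ultimately show ?thesis
      using \<open>M \<subseteq> E\<close> assms(2) by (auto simp: matchings_def pairwise_def image_mono)
  qed
  have "bij_betw ((`) g) (matchings f E) (matchings f' (g ` E))"
  proof (rule bij_betwI')
    fix M N assume "M \<in> matchings f E" "N \<in> matchings f E"
    then have "M \<subseteq> E" "N \<subseteq> E" by (auto simp: matchings_def)
    then show "g ` M = g ` N \<longleftrightarrow> M = N" using assms(1) by (simp add: inj_on_image_eq_iff)
  next
    fix M assume "M \<in> matchings f E"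
    then show "g ` M \<in> matchings f' (g ` E)" using eq by (simp add: matchings_def)
  next
    fix N assume N: "N \<in> matchings f' (g ` E)"
    then obtain M where "M \<subseteq> E" "N = g ` M" by (auto simp: matchings_def subset_image_iff)
    then show "\<exists>M\<in>matchings f E. N = g ` M" using N eq by blast
  qed
  then show ?thesis unfolding mcount_def by (simp add: bij_betw_same_card)
qed

lemma mcount_cong:
  assumes "\<And>e. e \<in> E \<Longrightarrow> f e = f' e"
  shows "mcount f E = mcount f' E"
  using mcount_reindex[of id E f f'] assms by simp

text \<open>Every matching is determined by its traces on the two sides, and no edge of one side
  obstructs an edge of the other, so the traces can be chosen independently.\<close>

lemma mcount_disjoint_Un:
  assumes "E1 \<inter> E2 = {}" and "\<And>e e'. e \<in> E1 \<Longrightarrow> e' \<in> E2 \<Longrightarrow> disjnt (f e) (f e')"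
  shows "mcount f (E1 \<union> E2) = mcount f E1 * mcount f E2"
proof -
  have "bij_betw (\<lambda>(M, N). M \<union> N) (matchings f E1 \<times> matchings f E2) (matchings f (E1 \<union> E2))"
  proof (rule bij_betw_byWitness[where f' = "\<lambda>M. (M \<inter> E1, M \<inter> E2)"])
    show "\<forall>a\<in>matchings f E1 \<times> matchings f E2.
        (\<lambda>M. (M \<inter> E1, M \<inter> E2)) ((\<lambda>(M, N). M \<union> N) a) = a"
      using assms(1) by (auto simp: matchings_def)
    show "\<forall>M\<in>matchings f (E1 \<union> E2). (\<lambda>(M, N). M \<union> N) (M \<inter> E1, M \<inter> E2) = M"
      by (auto simp: matchings_def)
    have "M \<union> N \<in> matchings f (E1 \<union> E2)" if "M \<in> matchings f E1" "N \<in> matchings f E2" for M N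
    proof -
      have "disjnt (f e) (f e')" if "e \<in> M \<union> N" "e' \<in> M \<union> N" "e \<noteq> e'" for e e'
        using that \<open>M \<in> _\<close> \<open>N \<in> _\<close> assms(2)[of e e'] assms(2)[of e' e]
        unfolding matchings_def pairwise_def by (auto simp: disjnt_sym subset_iff)
      then show ?thesis using that by (auto simp: matchings_def pairwise_def)
    qed
    then show "(\<lambda>(M, N). M \<union> N) ` (matchings f E1 \<times> matchings f E2) \<subseteq> matchings f (E1 \<union> E2)"
      by auto
    show "(\<lambda>M. (M \<inter> E1, M \<inter> E2)) ` matchings f (E1 \<union> E2) \<subseteq> matchings f E1 \<times> matchings f E2"
      by (auto simp: matchings_def pairwise_def)
  qed
  from bij_betw_same_card[OF this] show ?thesis
    by (simp add: mcount_def card_cartesian_product)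
qed

text \<open>Matchings are sorted by their trace on \<open>D\<close>, which is empty or a single edge
  \<open>e\<close>; in the second case the remaining edges come from \<open>E\<close> and avoid the
  ends of \<open>e\<close>. The case \<open>e = e'\<close> of \<open>int\<close> says that edges of
  \<open>D\<close> have a nonempty set of ends.\<close>

lemma mcount_Un_intersecting:
  assumes "finite E" and "finite D" and "E \<inter> D = {}"
    and int: "\<And>e e'. e \<in> D \<Longrightarrow> e' \<in> D \<Longrightarrow> \<not> disjnt (f e) (f e')"
  shows "mcount f (E \<union> D) = mcount f E + (\<Sum>e\<in>D. mcount f {e' \<in> E. disjnt (f e) (f e')})"
proof -
  let ?N = "\<lambda>e. {e' \<in> E. disjnt (f e) (f e')}"
  have split: "matchings f (E \<union> D) = matchings f E \<union> (\<Union>e\<in>D. insert e ` matchings f (?N e))"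
  proof (intro equalityI subsetI)
    fix M assume M: "M \<in> matchings f (E \<union> D)"
    show "M \<in> matchings f E \<union> (\<Union>e\<in>D. insert e ` matchings f (?N e))"
    proof (cases "M \<inter> D = {}")
      case True
      then show ?thesis using M by (auto simp: matchings_def)
    next
      case False
      then obtain e where e: "e \<in> M" "e \<in> D" by auto
      have disj: "disjnt (f e) (f e')" if "e' \<in> M - {e}" for e'
        using that e M by (auto simp: matchings_def pairwise_def)
      \<comment> \<open>A further edge from \<open>D\<close> would meet \<open>e\<close> by
        \<open>int\<close>, so the remaining edges lie in \<open>E\<close>.\<close>
      then have "M - {e} \<subseteq> ?N e"
        using e int M unfolding matchings_def by blast
      then have "M - {e} \<in> matchings f (?N e)"
        using M by (auto simp: matchings_def pairwise_def)
      moreover have "M = insert e (M - {e})" using e by auto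
      ultimately show ?thesis using e by blast
    qed
  next
    fix M assume "M \<in> matchings f E \<union> (\<Union>e\<in>D. insert e ` matchings f (?N e))"
    then show "M \<in> matchings f (E \<union> D)"
    proof
      assume "M \<in> matchings f E"
      then show ?thesis by (auto simp: matchings_def)
    next
      assume "M \<in> (\<Union>e\<in>D. insert e ` matchings f (?N e))"
      then obtain e M' where e: "e \<in> D" "M' \<in> matchings f (?N e)" "M = insert e M'" by auto
      then have "\<forall>e'\<in>M'. disjnt (f e) (f e') \<and> disjnt (f e') (f e)"
        by (auto simp: matchings_def disjnt_sym)
      then show ?thesis using e by (auto simp: matchings_def pairwise_insert)
    qed
  qed
  \<comment> \<open>The trace on \<open>D\<close> recovers \<open>e\<close>; this separates the
    blocks of the union from each other and from \<open>matchings f E\<close>.\<close>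
  have meets: "M \<inter> D = {e}" if "e \<in> D" "M \<in> insert e ` matchings f (?N e)" for e M
    using that assms(3) by (auto simp: matchings_def)
  have fin: "finite (insert e ` matchings f (?N e))" for e
    using assms(1) by (simp add: finite_matchings)
  have "card (\<Union>e\<in>D. insert e ` matchings f (?N e))
      = (\<Sum>e\<in>D. card (insert e ` matchings f (?N e)))"
  proof (rule card_UN_disjoint[OF assms(2)])
    show "\<forall>e\<in>D. finite (insert e ` matchings f (?N e))" using fin by blast
    show "\<forall>e\<in>D. \<forall>e'\<in>D. e \<noteq> e' \<longrightarrow>
        insert e ` matchings f (?N e) \<inter> insert e' ` matchings f (?N e') = {}"
    proof (intro ballI impI, rule ccontr)
      fix e e' assume e: "e \<in> D" "e' \<in> D" "e \<noteq> e'"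
        and "insert e ` matchings f (?N e) \<inter> insert e' ` matchings f (?N e') \<noteq> {}"
      then obtain M where "M \<in> insert e ` matchings f (?N e)" "M \<in> insert e' ` matchings f (?N e')"
        by blast
      from meets[OF e(1) this(1)] meets[OF e(2) this(2)] e(3) show False by simp
    qed
  qed
  also have "\<dots> = (\<Sum>e\<in>D. mcount f (?N e))"
  proof (rule sum.cong[OF refl])
    fix e assume "e \<in> D"
    then have "e \<notin> M" if "M \<in> matchings f (?N e)" for M
      using that assms(3) by (auto simp: matchings_def)
    then have "inj_on (insert e) (matchings f (?N e))"
      by (auto simp: inj_on_def dest: insert_ident)
    then show "card (insert e ` matchings f (?N e)) = mcount f (?N e)"
      by (simp add: card_image mcount_def)
  qed
  finally have cU: "card (\<Union>e\<in>D. insert e ` matchings f (?N e)) = (\<Sum>e\<in>D. mcount f (?N e))" .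
  have "M \<inter> D = {}" if "M \<in> matchings f E" for M
    using that assms(3) by (auto simp: matchings_def)
  then have "matchings f E \<inter> (\<Union>e\<in>D. insert e ` matchings f (?N e)) = {}"
    using meets by fastforce
  then show ?thesis
    unfolding mcount_def split using assms(1,2) fin
    by (subst card_Un_disjoint) (auto simp: finite_matchings cU[unfolded mcount_def])
qed

section \<open>Bonds and the spine recursion\<close>

text \<open>An edge of the bond \<open>B\<close> blocks exactly the edges at \<open>x\<close> on one
  side and at \<open>y\<close> on the other; deleting \<open>x\<close> destroys the whole bond and
  leaves \<open>E2\<close> intact. Nonempty ends on \<open>E1\<close> keep \<open>E1\<close> and
  \<open>E2\<close> disjoint. The condition \<open>y \<in> V2\<close> is imposed per edge of
  \<open>B\<close>, so that an empty bond at the end of a spine, where \<open>y\<close> has no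
  meaning, is covered.\<close>

lemma mcount_join:
  assumes fin: "finite E1" "finite E2" "finite B"
    and E1: "\<And>e. e \<in> E1 \<Longrightarrow> f e \<subseteq> V1 \<and> f e \<noteq> {}" and E2: "\<And>e. e \<in> E2 \<Longrightarrow> f e \<subseteq> V2"
    and V: "V1 \<inter> V2 = {}" and x: "x \<in> V1"
    and B: "\<And>e. e \<in> B \<Longrightarrow> y \<in> V2 \<and> f e = {x, y}"
  shows "mcount f (E1 \<union> E2 \<union> B) = mcount f E1 * mcount f E2
      + card B * (mcount f (avoiding f x E1) * mcount f (avoiding f y E2))"
    and "mcount f (avoiding f x (E1 \<union> E2 \<union> B)) = mcount f (avoiding f x E1) * mcount f E2"
proof -
  have E12: "E1 \<inter> E2 = {}" using E1 E2 V by blast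
  have prod: "mcount f (F1 \<union> F2) = mcount f F1 * mcount f F2" if "F1 \<subseteq> E1" "F2 \<subseteq> E2" for F1 F2
  proof (rule mcount_disjoint_Un)
    show "F1 \<inter> F2 = {}" using that E12 by auto
    show "disjnt (f e) (f e')" if "e \<in> F1" "e' \<in> F2" for e e'
      using that \<open>F1 \<subseteq> E1\<close> \<open>F2 \<subseteq> E2\<close> E1[of e] E2[of e'] V unfolding disjnt_def by blast
  qed
  have "(E1 \<union> E2) \<inter> B = {}" using E1 E2 V x B by blast
  then have "mcount f (E1 \<union> E2 \<union> B) = mcount f (E1 \<union> E2)
      + (\<Sum>e\<in>B. mcount f {e' \<in> E1 \<union> E2. disjnt (f e) (f e')})"
    using fin B by (intro mcount_Un_intersecting) (auto simp: disjnt_def)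
  also have "(\<Sum>e\<in>B. mcount f {e' \<in> E1 \<union> E2. disjnt (f e) (f e')})
      = (\<Sum>e\<in>B. mcount f (avoiding f x E1) * mcount f (avoiding f y E2))"
  proof (rule sum.cong[OF refl])
    fix e assume "e \<in> B"
    then have "{e' \<in> E1 \<union> E2. disjnt (f e) (f e')} = avoiding f x E1 \<union> avoiding f y E2"
      using B[of e] x E1 E2 V by (auto simp: avoiding_def disjnt_def; blast)
    then show "mcount f {e' \<in> E1 \<union> E2. disjnt (f e) (f e')}
        = mcount f (avoiding f x E1) * mcount f (avoiding f y E2)"
      by (simp add: prod avoiding_def)
  qed
  finally show "mcount f (E1 \<union> E2 \<union> B) = mcount f E1 * mcount f E2
      + card B * (mcount f (avoiding f x E1) * mcount f (avoiding f y E2))"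
    by (simp add: prod)
  have "avoiding f x (E1 \<union> E2 \<union> B) = avoiding f x E1 \<union> E2"
    using B x E2 V unfolding avoiding_def by blast
  then show "mcount f (avoiding f x (E1 \<union> E2 \<union> B)) = mcount f (avoiding f x E1) * mcount f E2"
    by (simp add: prod avoiding_def)
qed

text \<open>The uncancelled fraction of the spine beyond the root has denominator \<open>q\<close>,
  the count without the root. A matching of \<open>G\<close> leaves the root uncovered, uses one of
  the \<open>k\<close> pendant edges (each again leaving \<open>q\<close> choices), or uses an edge
  of the first bond, which accounts for \<open>p\<close>.\<close>

lemma hosoya_spine:
  assumes "spine_decomp G k w t d H"
    and pq: "ucfrac (map (\<lambda>i. (d i, hosoya (H i), hosoya (del_vert (H i) (w i)))) [1..<Suc t]) = (p, q)"
  shows "hosoya (del_vert G (w 0)) = q" and "hosoya G = (k + 1) * q + p"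
proof -
  define f where "f = ends G"
  obtain P where P: "card P = k" "verts G = {w 0} \<union> P \<union> (\<Union>j\<in>{1..t}. verts (H j))"
      "w 0 \<notin> P" "\<forall>j\<in>{1..t}. w 0 \<notin> verts (H j) \<and> P \<inter> verts (H j) = {}"
      "\<forall>p\<in>P. card (edges_between G (w 0) p) = 1"
      "\<forall>j\<in>{1..t}. card (edges_between G (w (j - 1)) (w j)) = d j"
      "edges G = (\<Union>p\<in>P. edges_between G (w 0) p)
                \<union> (\<Union>j\<in>{1..t}. edges_between G (w (j - 1)) (w j))
                \<union> (\<Union>j\<in>{1..t}. edges (H j))"
    using assms(1) unfolding spine_decomp_def by (elim conjE exE) (rule that)
  have G: "finite (verts G)" "finite (edges G)"
    and Hsub: "\<And>j. j \<in> {1..t} \<Longrightarrow> subgraph (H j) G"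
    and wH: "\<And>j. j \<in> {1..t} \<Longrightarrow> w j \<in> verts (H j)"
    and Hdisj: "disjoint_family_on (\<lambda>j. verts (H j)) {1..t}"
    using assms(1) by (auto simp: spine_decomp_def finite_multigraph_def)
  \<comment> \<open>Links outside the range are empty, so neither the end of the spine nor the case
    \<open>t = 0\<close> needs separate formulas.\<close>
  define B where "B j = (if j \<in> {1..t} then edges_between G (w (j - 1)) (w j) else {})" for j
  \<comment> \<open>\<open>T j\<close> is the edge set of the tail starting at \<open>w j\<close>.
    The link \<open>B j\<close>, which leads into this tail from \<open>w (j - 1)\<close>, is left
    out.\<close>
  define T where "T j = (\<Union>i\<in>{j..t}. edges (H i)) \<union> (\<Union>i\<in>{j<..t}. B i)" for j
  define V where "V j = (\<Union>i\<in>{j..t}. verts (H i))" for j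
  have fH: "f e = ends (H j) e" "f e \<subseteq> verts (H j)" "f e \<noteq> {}"
    if "j \<in> {1..t}" "e \<in> edges (H j)" for j e
  proof -
    have e: "ends (H j) e = f e" "ends (H j) e \<subseteq> verts (H j)" "card (ends (H j) e) = 2"
      using Hsub[OF that(1)] that(2) unfolding subgraph_def finite_multigraph_def f_def by blast+
    then show "f e = ends (H j) e" "f e \<subseteq> verts (H j)" "f e \<noteq> {}" by auto
  qed
  have finH: "finite (edges (H j))" if "j \<in> {1..t}" for j
    using Hsub[OF that] by (simp add: subgraph_def finite_multigraph_def)
  have hosH: "hosoya (H j) = mcount f (edges (H j))"
      "hosoya (del_vert (H j) (w j)) = mcount f (avoiding f (w j) (edges (H j)))"
    if "j \<in> {1..t}" for j
  proof -
    show "hosoya (H j) = mcount f (edges (H j))"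
      unfolding hosoya_eq_mcount using fH(1) that by (intro mcount_cong) simp
    have "avoiding f (w j) (edges (H j)) = avoiding (ends (H j)) (w j) (edges (H j))"
      using fH(1) that by (auto simp: avoiding_def)
    then show "hosoya (del_vert (H j) (w j)) = mcount f (avoiding f (w j) (edges (H j)))"
      unfolding hosoya_del_vert_eq_mcount using fH(1) that
      by (simp, intro mcount_cong) (simp add: avoiding_def)
  qed
  have finB: "finite (B j)" for j
    using G by (simp add: B_def edges_between_def)
  have fB: "j \<in> {1..t} \<and> f e = {w (j - 1), w j}" if "e \<in> B j" for e j
    using that by (auto simp: B_def edges_between_def f_def split: if_splits)
  have finT: "finite (T j)" if "j \<ge> 1" for j
    unfolding T_def using finH finB that by auto
  have fT: "f e \<subseteq> V j" if "e \<in> T j" "j \<ge> 1" for e j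
    using that(1) unfolding T_def
  proof
    assume "e \<in> (\<Union>i\<in>{j..t}. edges (H i))"
    then obtain i where i: "i \<in> {j..t}" "e \<in> edges (H i)" by auto
    then have "f e \<subseteq> verts (H i)" using fH(2) \<open>j \<ge> 1\<close> by auto
    then show ?thesis using i(1) unfolding V_def by blast
  next
    assume "e \<in> (\<Union>i\<in>{j<..t}. B i)"
    then obtain i where i: "i \<in> {j<..t}" "e \<in> B i" by auto
    have "w i \<in> verts (H i)" "w (i - 1) \<in> verts (H (i - 1))"
      using i \<open>j \<ge> 1\<close> by (auto intro!: wH)
    moreover have "i \<in> {j..t}" "i - 1 \<in> {j..t}" using i by auto
    ultimately have "w i \<in> V j" "w (i - 1) \<in> V j" unfolding V_def by (auto simp only: UN_iff)
    then show ?thesis using fB[OF i(2)] by simp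
  qed
  \<comment> \<open>The invariant, proved downwards from \<open>Suc t\<close>. Writing
    \<open>card (B j)\<close> instead of \<open>d j\<close> makes the starting pair
    \<open>(0, 1)\<close>, the value of the empty fraction.\<close>
  have tail: "ucfrac (map (\<lambda>i. (d i, hosoya (H i), hosoya (del_vert (H i) (w i)))) [j..<Suc t])
      = (card (B j) * mcount f (avoiding f (w j) (T j)), mcount f (T j))"
    if "j \<le> Suc t" "1 \<le> j" for j
    using that
  proof (induction j rule: inc_induct)
    case base
    then show ?case by (simp add: T_def B_def)
  next
    case (step j)
    then have j: "j \<in> {1..t}" by auto
    have Tj: "T j = edges (H j) \<union> T (Suc j) \<union> B (Suc j)"
    proof -
      have "{j..t} = insert j {Suc j..t}" using j by auto
      moreover have "(\<Union>i\<in>{j<..t}. B i) = (\<Union>i\<in>{Suc j<..t}. B i) \<union> B (Suc j)"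
      proof (cases "j = t")
        case True
        then show ?thesis by (simp add: B_def)
      next
        case False
        then have "{j<..t} = insert (Suc j) {Suc j<..t}" using j by auto
        then show ?thesis by auto
      qed
      ultimately show ?thesis unfolding T_def by auto
    qed
    have VV: "verts (H j) \<inter> V (Suc j) = {}"
    proof -
      have "verts (H j) \<inter> verts (H i) = {}" if "i \<in> {Suc j..t}" for i
        using disjoint_family_onD[OF Hdisj j, of i] that by simp
      then show ?thesis unfolding V_def by (simp only: Int_UN_distrib) simp
    qed
    have BS: "w (Suc j) \<in> V (Suc j) \<and> f e = {w j, w (Suc j)}" if "e \<in> B (Suc j)" for e
      using fB[OF that] wH[of "Suc j"] by (auto simp: V_def)
    have E1: "f e \<subseteq> verts (H j) \<and> f e \<noteq> {}" if "e \<in> edges (H j)" for e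
      using fH j that by blast
    have E2: "f e \<subseteq> V (Suc j)" if "e \<in> T (Suc j)" for e
      using fT that by simp
    have finTS: "finite (T (Suc j))" using finT by simp
    \<comment> \<open>These are the numerator and denominator produced by \<open>ufrac_add\<close>
      from the pair of \<open>H j\<close> and the pair of the next tail; \<open>ufrac_div\<close>
      then exchanges them and multiplies the new numerator by \<open>d j\<close>.\<close>
    have join: "mcount f (T j) = mcount f (edges (H j)) * mcount f (T (Suc j))
          + card (B (Suc j)) * (mcount f (avoiding f (w j) (edges (H j)))
            * mcount f (avoiding f (w (Suc j)) (T (Suc j))))"
        "mcount f (avoiding f (w j) (T j))
          = mcount f (avoiding f (w j) (edges (H j))) * mcount f (T (Suc j))"
      unfolding Tj by (rule mcount_join[OF finH[OF j] finTS finB _ _ VV wH[OF j]];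
          use E1 E2 BS in blast)+
    have "card (B j) = d j" using j P(6) by (simp add: B_def)
    moreover have "[j..<Suc t] = j # [Suc j..<Suc t]" using j by (simp add: upt_conv_Cons)
    ultimately show ?case
      using step.IH j
      by (simp add: ufrac_div_def ufrac_add_def join hosH algebra_simps del: upt_Suc)
  qed
  have pq': "p = card (B 1) * mcount f (avoiding f (w 1) (T 1))" "q = mcount f (T 1)"
    using tail[of 1] pq by auto
  define D where "D = (\<Union>p\<in>P. edges_between G (w 0) p)"
  have fD: "\<exists>p\<in>P. f e = {w 0, p}" if "e \<in> D" for e
    using that by (auto simp: D_def edges_between_def f_def)
  have w0V: "w 0 \<notin> V 1" and PV: "P \<inter> V 1 = {}" using P(4) by (auto simp: V_def)
  have fT1: "f e \<subseteq> V 1" if "e \<in> T 1" for e using fT that by simp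
  \<comment> \<open>The edges are separated into those missing \<open>w 0\<close>, namely
    \<open>T 1\<close>, and the pairwise intersecting ones at \<open>w 0\<close>.\<close>
  have EG: "edges G = T 1 \<union> (D \<union> B 1)"
  proof -
    have "(\<Union>j\<in>{1..t}. edges_between G (w (j - 1)) (w j)) = (\<Union>j\<in>{1..t}. B j)"
      by (simp add: B_def)
    also have "\<dots> = (\<Union>i\<in>{1<..t}. B i) \<union> B 1"
    proof (cases "t = 0")
      case False
      then have "{1..t} = insert 1 {1<..t}" by auto
      then show ?thesis by auto
    qed (simp add: B_def)
    finally show ?thesis using P(7) unfolding T_def D_def by auto
  qed
  have w0: "w 0 \<in> f e" if "e \<in> D \<union> B 1" for e
    using that fD fB[of e 1] by auto
  have "avoiding f (w 0) (edges G) = T 1"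
    using w0 fT1 w0V unfolding EG avoiding_def by blast
  then show "hosoya (del_vert G (w 0)) = q"
    unfolding hosoya_del_vert_eq_mcount using pq' by (simp add: f_def)
  have finP: "finite P" using P(2) G(1) by simp
  have cardD: "card D = k"
  proof -
    have "card D = (\<Sum>p\<in>P. card (edges_between G (w 0) p))"
      unfolding D_def
    proof (rule card_UN_disjoint[OF finP])
      show "\<forall>p\<in>P. finite (edges_between G (w 0) p)"
        using G by (simp add: edges_between_def)
      show "\<forall>p\<in>P. \<forall>p'\<in>P. p \<noteq> p' \<longrightarrow> edges_between G (w 0) p \<inter> edges_between G (w 0) p' = {}"
        using P(3) by (auto simp: edges_between_def doubleton_eq_iff)
    qed
    then show ?thesis using P(1,5) by simp
  qed
  have finD: "finite D" using EG G(2) by simp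
  have DB: "D \<inter> B 1 = {}"
  proof -
    have False if "e \<in> D" "e \<in> B 1" for e
    proof -
      have "1 \<in> {1..t}" "f e = {w 0, w 1}" using fB[OF that(2)] by auto
      moreover obtain p where "p \<in> P" "f e = {w 0, p}" using fD[OF \<open>e \<in> D\<close>] by blast
      ultimately show False using P(4) wH[of 1] by (auto simp: doubleton_eq_iff)
    qed
    then show ?thesis by blast
  qed
  have "hosoya G = mcount f (T 1 \<union> (D \<union> B 1))"
    using EG by (simp add: hosoya_eq_mcount f_def)
  also have "\<dots> = mcount f (T 1) + (\<Sum>e\<in>D \<union> B 1. mcount f {e' \<in> T 1. disjnt (f e) (f e')})"
  proof (rule mcount_Un_intersecting)
    show "T 1 \<inter> (D \<union> B 1) = {}" using w0 fT1 w0V by blast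
    show "\<not> disjnt (f e) (f e')" if "e \<in> D \<union> B 1" "e' \<in> D \<union> B 1" for e e'
      using w0 that by (auto simp: disjnt_def)
  qed (use finT finD finB in auto)
  also have "(\<Sum>e\<in>D \<union> B 1. mcount f {e' \<in> T 1. disjnt (f e) (f e')})
      = (\<Sum>e\<in>D. mcount f {e' \<in> T 1. disjnt (f e) (f e')})
        + (\<Sum>e\<in>B 1. mcount f {e' \<in> T 1. disjnt (f e) (f e')})"
    using finD finB DB by (rule sum.union_disjoint)
  \<comment> \<open>A pendant edge has no end in the tail, so it blocks nothing there.\<close>
  also have "(\<Sum>e\<in>D. mcount f {e' \<in> T 1. disjnt (f e) (f e')}) = (\<Sum>e\<in>D. mcount f (T 1))"
  proof (rule sum.cong[OF refl])
    fix e assume "e \<in> D"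
    from fD[OF this] obtain p where "p \<in> P" "f e = {w 0, p}" by blast
    then have "disjnt (f e) (V 1)" using w0V PV by auto
    then have "disjnt (f e) (f e')" if "e' \<in> T 1" for e'
      using fT1[OF that] by (rule disjnt_subset2)
    then have "{e' \<in> T 1. disjnt (f e) (f e')} = T 1" by auto
    then show "mcount f {e' \<in> T 1. disjnt (f e) (f e')} = mcount f (T 1)" by simp
  qed
  \<comment> \<open>A link edge reaches the tail only at \<open>w 1\<close>, so it blocks exactly
    the edges at \<open>w 1\<close>.\<close>
  also have "(\<Sum>e\<in>B 1. mcount f {e' \<in> T 1. disjnt (f e) (f e')})
      = (\<Sum>e\<in>B 1. mcount f (avoiding f (w 1) (T 1)))"
  proof (rule sum.cong[OF refl])
    fix e assume "e \<in> B 1"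
    then have "f e = {w 0, w 1}" using fB[of e 1] by simp
    moreover have "w 0 \<notin> f e'" if "e' \<in> T 1" for e'
      using fT1[OF that] w0V by auto
    ultimately have "{e' \<in> T 1. disjnt (f e) (f e')} = avoiding f (w 1) (T 1)"
      by (auto simp: avoiding_def)
    then show "mcount f {e' \<in> T 1. disjnt (f e) (f e')} = mcount f (avoiding f (w 1) (T 1))"
      by simp
  qed
  finally show "hosoya G = (k + 1) * q + p"
    using cardD pq' by simp
qed

section \<open>Gluing copies at a common root\<close>

text \<open>Here \<open>s\<close> counts the matchings of \<open>R\<close> that cover
  \<open>r\<close>; stating this as a sum avoids subtraction on naturals. All root edges of all
  copies meet in \<open>None\<close>, so at most one copy contributes such a matching, and each
  other copy contributes a matching of \<open>R\<close> without its root.\<close>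

lemma hosoya_radial_graph:
  assumes R: "finite_multigraph R" and Z: "hosoya R = hosoya (del_vert R r) + s"
  shows "hosoya (radial_graph m R r)
    = hosoya (del_vert R r) ^ m + m * s * hosoya (del_vert R r) ^ (m - 1)"
proof -
  define f where "f = ends R"
  define g where "g = ends (radial_graph m R r)"
  define E where "E = avoiding f r (edges R)"
  define D where "D = {e \<in> edges R. r \<in> f e}"
  define q where "q = mcount f E"
  have g: "g (i, e) = radial_vertex r i ` f e" for i e
    by (simp add: g_def f_def radial_graph_def)
  have ED: "edges R = E \<union> D" "E \<inter> D = {}" by (auto simp: E_def D_def avoiding_def)
  have fin: "finite E" "finite D"
    using R ED(1) by (auto simp: finite_multigraph_def)
  have inj: "inj (radial_vertex r i)" for i
    by (auto simp: inj_def radial_vertex_def)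
  have same: "disjnt (g (i, e)) (g (i, e')) \<longleftrightarrow> disjnt (f e) (f e')" for i e e'
    unfolding g disjnt_def using image_Int[OF inj] by (metis image_is_empty)
  \<comment> \<open>Distinct copies share only the vertex \<open>None\<close>, so it suffices that
    one of the two edges misses the root.\<close>
  have other: "disjnt (g (i, e)) (g (j, e'))" if "i \<noteq> j" "e \<in> edges R" "e' \<in> E" for i j e e'
    using that by (auto simp: g disjnt_def radial_vertex_def E_def avoiding_def split: if_splits)
  \<comment> \<open>The edge set may vary with the copy, because a chosen root edge thins out its
    own copy only.\<close>
  have copies: "mcount g (Sigma I F) = (\<Prod>i\<in>I. mcount f (F i))"
    if "finite I" "\<And>i. F i \<subseteq> E" for I F
    using that(1)
  proof (induction I rule: finite_induct)
    case empty
    then show ?case by simp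
  next
    case (insert i I)
    have "Sigma (insert i I) F = Pair i ` F i \<union> Sigma I F" by auto
    also have "mcount g \<dots> = mcount g (Pair i ` F i) * mcount g (Sigma I F)"
    proof (rule mcount_disjoint_Un)
      show "Pair i ` F i \<inter> Sigma I F = {}" using insert.hyps by auto
      show "disjnt (g x) (g y)" if "x \<in> Pair i ` F i" "y \<in> Sigma I F" for x y
      proof -
        obtain e j e' where xy: "x = (i, e)" "e \<in> F i" "y = (j, e')" "j \<in> I" "e' \<in> F j"
          using \<open>x \<in> _\<close> \<open>y \<in> _\<close> by auto
        moreover have "e \<in> edges R" "e' \<in> E" using xy \<open>\<And>i. F i \<subseteq> E\<close> ED(1) by auto
        ultimately show ?thesis using other insert.hyps(2) by metis
      qed
    qed
    also have "mcount g (Pair i ` F i) = mcount f (F i)"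
      using same by (intro mcount_reindex) (auto simp: inj_on_def)
    finally show ?case using insert by simp
  qed
  \<comment> \<open>Applying the intersecting-family count to a single copy identifies
    \<open>s\<close> with the sum over its root edges.\<close>
  let ?N = "\<lambda>e. {e' \<in> E. disjnt (f e) (f e')}"
  have "mcount f (edges R) = mcount f E + (\<Sum>e\<in>D. mcount f (?N e))"
    unfolding ED(1)
    by (rule mcount_Un_intersecting[OF fin ED(2)]) (auto simp: D_def disjnt_def)
  moreover have Zq: "hosoya (del_vert R r) = q"
    by (simp add: hosoya_del_vert_eq_mcount q_def E_def f_def)
  ultimately have s: "s = (\<Sum>e\<in>D. mcount f (?N e))"
    using Z by (simp add: hosoya_eq_mcount f_def[symmetric] q_def)
  have "hosoya (radial_graph m R r) = mcount g ({..<m} \<times> E \<union> {..<m} \<times> D)"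
    by (simp add: hosoya_eq_mcount g_def[symmetric]) (simp add: radial_graph_def ED(1) Sigma_Un_distrib2)
  also have "\<dots> = mcount g ({..<m} \<times> E)
      + (\<Sum>x\<in>{..<m} \<times> D. mcount g {y \<in> {..<m} \<times> E. disjnt (g x) (g y)})"
  proof (rule mcount_Un_intersecting)
    show "({..<m} \<times> E) \<inter> ({..<m} \<times> D) = {}" using ED(2) by auto
    have "None \<in> g x" if "x \<in> {..<m} \<times> D" for x
    proof -
      obtain i e where x: "x = (i, e)" "e \<in> D" using \<open>x \<in> _\<close> by auto
      then have "r \<in> f e" by (simp add: D_def)
      then show ?thesis unfolding x(1) g by (auto simp: image_iff radial_vertex_def)
    qed
    then show "\<not> disjnt (g x) (g y)" if "x \<in> {..<m} \<times> D" "y \<in> {..<m} \<times> D" for x y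
      using that by (meson disjnt_iff)
  qed (use fin in auto)
  also have "mcount g ({..<m} \<times> E) = q ^ m"
    using copies[of "{..<m}" "\<lambda>_. E"] by (simp add: q_def)
  also have "(\<Sum>x\<in>{..<m} \<times> D. mcount g {y \<in> {..<m} \<times> E. disjnt (g x) (g y)})
      = (\<Sum>(i, e)\<in>{..<m} \<times> D. mcount f (?N e) * q ^ (m - 1))"
  proof (rule sum.cong[OF refl])
    fix x assume "x \<in> {..<m} \<times> D"
    then obtain i e where x: "x = (i, e)" "i < m" "e \<in> D" by auto
    \<comment> \<open>Copy \<open>i\<close>, which contains the chosen root edge, keeps only the
      edges disjoint from it; every other copy keeps all of \<open>E\<close>.\<close>
    let ?F = "\<lambda>j. if j = i then ?N e else E"
    have eR: "e \<in> edges R" using x ED(1) by auto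
    have "{y \<in> {..<m} \<times> E. disjnt (g x) (g y)} = Sigma {..<m} ?F"
      using other[OF _ eR] same unfolding x(1) by (auto split: if_splits)
    then have "mcount g {y \<in> {..<m} \<times> E. disjnt (g x) (g y)} = (\<Prod>j<m. mcount f (?F j))"
      using copies[of "{..<m}" ?F] by auto
    also have "\<dots> = mcount f (?F i) * (\<Prod>j\<in>{..<m} - {i}. mcount f (?F j))"
      using x(2) by (intro prod.remove) auto
    also have "(\<Prod>j\<in>{..<m} - {i}. mcount f (?F j)) = (\<Prod>j\<in>{..<m} - {i}. q)"
      by (rule prod.cong) (auto simp: q_def)
    finally show "mcount g {y \<in> {..<m} \<times> E. disjnt (g x) (g y)}
        = (case x of (i, e) \<Rightarrow> mcount f (?N e) * q ^ (m - 1))"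
      using x by simp
  qed
  also have "\<dots> = m * s * q ^ (m - 1)"
    by (simp add: sum.cartesian_product[symmetric] s sum_distrib_right)
  finally show ?thesis by (simp add: Zq)
qed

section \<open>Formal fractions and their real values\<close>

text \<open>Each unreduced addition multiplies the denominator by \<open>q\<close> and adds
  \<open>p\<close> times the old denominator to the numerator. At \<open>m = 0\<close> the truncated
  exponent \<open>m - 1\<close> is harmless because of the factor \<open>m\<close>.\<close>

lemma umcfrac_eq:
  assumes "ucfrac xs = (p, q)"
  shows "umcfrac c m xs = (c * q ^ m + m * p * q ^ (m - 1), q ^ m)"
proof (induction m)
  case 0
  then show ?case by (simp add: umcfrac_def)
next
  case (Suc m)
  then show ?case
    using assms by (cases m) (simp_all add: umcfrac_def ufrac_add_def algebra_simps)
qed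

text \<open>Each division turns a numerator into a denominator, so positivity of both entries of
  every pair keeps all denominators nonzero; the positivity conjunct carries this through the
  induction.\<close>

lemma cfrac_eq_ucfrac:
  assumes "\<forall>x\<in>set xs. fst (snd x) > 0 \<and> snd (snd x) > 0"
  shows "snd (ucfrac xs) > 0 \<and>
    cfrac (map (\<lambda>(b, p, q). (b, real p / real q)) xs) = real (fst (ucfrac xs)) / real (snd (ucfrac xs))"
  using assms
proof (induction xs)
  case Nil
  then show ?case by simp
next
  case (Cons x xs)
  obtain b p q where x: "x = (b, p, q)" by (cases x)
  obtain p' q' where u: "ucfrac xs = (p', q')" by (cases "ucfrac xs")
  have pos: "p > 0" "q > 0" "q' > 0" using Cons x u by auto
  have "real p / real q + real p' / real q' = (real p * real q' + real p' * real q) / (real q * real q')"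
    using pos by (simp add: add_frac_eq)
  then show ?case
    using Cons x u pos by (simp add: ufrac_div_def ufrac_add_def)
qed

lemma finite_multigraph_hosoya_pos:
  assumes "finite_multigraph G"
  shows "hosoya G > 0" and "hosoya (del_vert G x) > 0"
  using assms unfolding hosoya_del_vert_eq_mcount unfolding hosoya_eq_mcount
  by (simp_all add: finite_multigraph_def mcount_pos avoiding_def)

lemma hosoya_spine_cfrac:
  assumes "spine_decomp G k w t d H"
    and A: "\<forall>j\<in>{1..t}. A j = real (hosoya (H j)) / real (hosoya (del_vert (H j) (w j)))"
  shows "real (hosoya G) = real (hosoya (del_vert G (w 0)))
    * (real k + 1 + cfrac (map (\<lambda>j. (d j, A j)) [1..<Suc t]))"
proof -
  let ?xs = "map (\<lambda>j. (d j, hosoya (H j), hosoya (del_vert (H j) (w j)))) [1..<Suc t]"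
  obtain p q where pq: "ucfrac ?xs = (p, q)" by (cases "ucfrac ?xs")
  have "finite_multigraph (H j)" if "j \<in> {1..t}" for j
    using assms(1) that by (auto simp: spine_decomp_def subgraph_def)
  then have "\<forall>x\<in>set ?xs. fst (snd x) > 0 \<and> snd (snd x) > 0"
    by (auto simp: finite_multigraph_hosoya_pos simp del: upt_Suc)
  from cfrac_eq_ucfrac[OF this]
  have q: "q > 0" and "cfrac (map (\<lambda>(b, p, q). (b, real p / real q)) ?xs) = real p / real q"
    unfolding pq by auto
  moreover have "map (\<lambda>(b, p, q). (b, real p / real q)) ?xs = map (\<lambda>j. (d j, A j)) [1..<Suc t]"
    using A by (auto simp del: upt_Suc)
  ultimately have "cfrac (map (\<lambda>j. (d j, A j)) [1..<Suc t]) = real p / real q" by metis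
  then show ?thesis
    using hosoya_spine[OF assms(1) pq] q by (simp add: field_simps del: upt_Suc)
qed

section \<open>Branched continued fractions as ratios of Hosoya indices\<close>

text \<open>This is one unfolding of \<open>bcf_value\<close>: once the branches have their ratios
  as values, so does the root.\<close>

lemma spine_decomp_ratio:
  assumes "spine_decomp G k w t d H"
    and "\<forall>j\<in>{1..t}. A j = real (hosoya (H j)) / real (hosoya (del_vert (H j) (w j)))"
  shows "real k + 1 + cfrac (map (\<lambda>j. (d j, A j)) [1..<Suc t])
    = real (hosoya G) / real (hosoya (del_vert G (w 0)))"
proof -
  have "finite_multigraph G" using assms(1) by (simp add: spine_decomp_def)
  then have "real (hosoya (del_vert G (w 0))) \<noteq> 0"
    using finite_multigraph_hosoya_pos(2)[of G "w 0"] by simp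
  then show ?thesis using hosoya_spine_cfrac[OF assms] by simp
qed

text \<open>The ratio refers to the graph and its root alone, so the value cannot depend on the
  decomposition from which it is read off.\<close>

lemma bcf_value_imp_ratio:
  "bcf_value G r x \<Longrightarrow> x = real (hosoya G) / real (hosoya (del_vert G r))"
proof (induction rule: bcf_value.induct)
  case (1 G k w t d H x)
  then show ?case by (intro spine_decomp_ratio) auto
qed

lemma caterpillar_bond_imp_bcf_value:
  "caterpillar_bond G r \<Longrightarrow> \<exists>x. bcf_value G r x"
proof (induction rule: caterpillar_bond.induct)
  case (1 G k w t d H)
  then have "\<forall>j\<in>{1..t}. \<exists>x. bcf_value (H j) (w j) x" by blast
  then obtain x where "\<forall>j\<in>{1..t}. bcf_value (H j) (w j) (x j)" by metis
  then show ?case using 1 bcf_value.intros by blast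
qed

lemma star_ratio:
  assumes "star G c k"
  shows "real (hosoya G) / real (hosoya (del_vert G c)) = real k + 1"
proof -
  \<comment> \<open>A star is a spine of length \<open>t = 0\<close>: all leaves are pendant at the
    root and the continued fraction is empty.\<close>
  have "spine_decomp G k (\<lambda>_. c) 0 (\<lambda>_. 1) (\<lambda>_. G)"
    using assms unfolding spine_decomp_def star_def
    by (auto simp: disjoint_family_on_def intro!: exI[of _ "verts G - {c}"])
  from spine_decomp_ratio[OF this] show ?thesis by simp
qed

theorem theorem2:
  fixes m n a0 :: nat and b :: "nat \<Rightarrow> nat"
    and R :: "('v, 'e) mgraph" and v :: "nat \<Rightarrow> 'v" and H :: "nat \<Rightarrow> ('v, 'e) mgraph"
    and A :: "nat \<Rightarrow> real"
  assumes "m \<ge> 1" and "n \<ge> 1" and "a0 \<ge> 1" and "\<forall>i\<in>{1..n}. b i \<ge> 1"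
    and "radial_part R v n a0 b H"
    and "\<forall>i\<in>{1..n}. A i = real (hosoya (H i)) / real (hosoya (del_vert (H i) (v i)))"
  shows "(\<forall>i\<in>{1..n}. \<forall>c\<ge>1. star (H i) (v i) (c - 1) \<longrightarrow> A i = real c)
    \<and> (\<forall>i\<in>{1..n}. \<forall>x. bcf_value (H i) (v i) x \<longleftrightarrow> x = A i)
    \<and> umcfrac (m * (a0 - 1) + 1) m
         (map (\<lambda>i. (b i, hosoya (H i), hosoya (del_vert (H i) (v i)))) [1..<Suc n])
       = (hosoya (radial_graph m R (v 0)), hosoya (del_vert R (v 0)) ^ m)
    \<and> real (hosoya (radial_graph m R (v 0))) =
         real (hosoya (del_vert R (v 0))) ^ m *
         (real m * (real a0 - 1) + 1 + real m * cfrac (map (\<lambda>i. (b i, A i)) [1..<Suc n]))"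
proof (intro conjI)
  have sd: "spine_decomp R (a0 - 1) v n b H"
    and cb: "\<forall>i\<in>{1..n}. caterpillar_bond (H i) (v i)"
    using assms(5) by (auto simp: radial_part_def)
  have R: "finite_multigraph R" using sd by (simp add: spine_decomp_def)
  show "\<forall>i\<in>{1..n}. \<forall>c\<ge>1. star (H i) (v i) (c - 1) \<longrightarrow> A i = real c"
    using assms(6) star_ratio by fastforce
  \<comment> \<open>Every value equals the ratio \<open>A i\<close>, and membership in the class
    supplies some value, which must then be \<open>A i\<close>.\<close>
  show "\<forall>i\<in>{1..n}. \<forall>x. bcf_value (H i) (v i) x \<longleftrightarrow> x = A i"
    using assms(6) cb bcf_value_imp_ratio caterpillar_bond_imp_bcf_value by metis
  let ?xs = "map (\<lambda>i. (b i, hosoya (H i), hosoya (del_vert (H i) (v i)))) [1..<Suc n]"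
  let ?C = "cfrac (map (\<lambda>i. (b i, A i)) [1..<Suc n])"
  obtain p q where pq: "ucfrac ?xs = (p, q)" by (cases "ucfrac ?xs")
  note Z = hosoya_spine[OF sd pq]
  \<comment> \<open>The role of \<open>s\<close> is taken by the matchings covering
    \<open>v 0\<close>: \<open>q\<close> for each of the \<open>a0 - 1\<close> pendant edges, and
    \<open>p\<close> for the first bond.\<close>
  have "hosoya R = hosoya (del_vert R (v 0)) + ((a0 - 1) * q + p)"
    using Z by simp
  from hosoya_radial_graph[OF R this, of m]
  have G: "hosoya (radial_graph m R (v 0)) = q ^ m + m * ((a0 - 1) * q + p) * q ^ (m - 1)"
    unfolding Z(1) .
  \<comment> \<open>Here \<open>m \<ge> 1\<close> matters: one factor \<open>q\<close> of the common
    denominator is split off to match the terms with exponent \<open>m - 1\<close>.\<close>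
  have qm: "q ^ m = q * q ^ (m - 1)" using assms(1) by (cases m) auto
  show "umcfrac (m * (a0 - 1) + 1) m ?xs
      = (hosoya (radial_graph m R (v 0)), hosoya (del_vert R (v 0)) ^ m)"
    unfolding umcfrac_eq[OF pq] Z(1) G by (simp add: qm algebra_simps)
  have a0: "real (a0 - 1) = real a0 - 1" using assms(3) by simp
  \<comment> \<open>Both spine lemmas evaluate \<open>hosoya R\<close>, one as
    \<open>a0 * q + p\<close> and one as \<open>q * (a0 + ?C)\<close>; comparing them gives the
    equation.\<close>
  have "real q * ?C = real p"
    using hosoya_spine_cfrac[OF sd assms(6)] unfolding Z by (simp add: distrib_left del: upt_Suc)
  moreover have "real (hosoya (radial_graph m R (v 0)))
      = real q ^ m + real m * ((real a0 - 1) * real q + real p) * real q ^ (m - 1)"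
    unfolding G a0[symmetric] by simp
  moreover have "real q ^ m = real q * real q ^ (m - 1)"
    using assms(1) by (cases m) auto
  ultimately show "real (hosoya (radial_graph m R (v 0))) = real (hosoya (del_vert R (v 0))) ^ m *
      (real m * (real a0 - 1) + 1 + real m * ?C)"
    unfolding Z(1) by (simp add: algebra_simps del: upt_Suc)
qed

end
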